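(* Let $k\ge 2$ be an integer. If multisets $f$ and $g$ on $\mathbb{Z}_2^{k-1}$ have distinguishing number $k$, then some element of $\mathbb{Z}_2^{k-1}$ has multiplicity at least $k$ in $f$ or in $g$ (i.e. $f(x)\ge k$ or $g(x)\ge k$ for some $x$).
   Context: A multiset on $\mathbb{Z}_2^m$ is a function $\phi:\mathbb{Z}_2^m\to\mathbb{N}$; $\phi(x)$ is the multiplicity of $x$. Its $i$-deck is $\mathrm{deck}_i\phi(s_1,\dots,s_i)=\sum_{g\in\mathbb{Z}_2^m}\phi(g+s_1)\cdots\phi(g+s_i)$. Two multisets are $k$-indistinguishable if their $i$-decks agree for all $i\le k$, and $k$-distinguishable otherwise; their distinguishing number is the smallest $k$ for which they are $k$-distinguishable. *)

theory Defs
  imports "HOL-Analysis.Finite_Cartesian_Product" "HOL-Library.Z2"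
begin

text \<open>The type \<open>bit\<close> is not declared finite in its theory; without this, finiteness of the
  summation range \<open>UNIV\<close> in the deck would not be available.\<close>

instance bit :: finite
proof
  have "(UNIV :: bit set) = {0, 1}"
    by (auto intro: bit_not_zero_iff [THEN iffD1])
  then show "finite (UNIV :: bit set)"
    by (metis finite.emptyI finite.insertI)
qed

text \<open>
  A multiset on \<open>\<int>\<^sub>2\<^sup>m\<close> is a function \<open>bit ^ 'm \<Rightarrow> nat\<close>, with \<open>CARD('m)\<close> as the dimension.
  An \<open>i\<close>-tuple \<open>(s\<^sub>1, \<dots>, s\<^sub>i)\<close> is given by the values of a sequence \<open>s\<close> on \<open>{1..i}\<close>.
\<close>

definition deck :: "nat \<Rightarrow> (bit ^ 'm \<Rightarrow> nat) \<Rightarrow> (nat \<Rightarrow> bit ^ 'm) \<Rightarrow> nat" where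
  "deck i \<phi> s = (\<Sum>g\<in>UNIV. \<Prod>j=1..i. \<phi> (g + s j))"

definition indistinguishable :: "nat \<Rightarrow> (bit ^ 'm \<Rightarrow> nat) \<Rightarrow> (bit ^ 'm \<Rightarrow> nat) \<Rightarrow> bool" where
  "indistinguishable k \<phi> \<psi> \<longleftrightarrow> (\<forall>i\<le>k. \<forall>s. deck i \<phi> s = deck i \<psi> s)"

abbreviation distinguishable :: "nat \<Rightarrow> (bit ^ 'm \<Rightarrow> nat) \<Rightarrow> (bit ^ 'm \<Rightarrow> nat) \<Rightarrow> bool" where
  "distinguishable k \<phi> \<psi> \<equiv> \<not> indistinguishable k \<phi> \<psi>"

text \<open>
  The distinguishing number is a relation because multisets that are translates of each other
  are never distinguishable and so have none.
\<close>

definition has_distinguishing_number ::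
    "(bit ^ 'm \<Rightarrow> nat) \<Rightarrow> (bit ^ 'm \<Rightarrow> nat) \<Rightarrow> nat \<Rightarrow> bool" where
  "has_distinguishing_number \<phi> \<psi> k \<longleftrightarrow>
     distinguishable k \<phi> \<psi> \<and> (\<forall>j. distinguishable j \<phi> \<psi> \<longrightarrow> k \<le> j)"

end

theory Submission
  imports Defs
begin

text \<open>
  On the Fourier side, agreement of the \<open>i\<close>-decks says that \<open>\<Prod>\<^sub>j f^(y\<^sub>j) = \<Prod>\<^sub>j g^(y\<^sub>j)\<close> whenever
  \<open>y\<^sub>1 + \<dots> + y\<^sub>i = 0\<close>. Distinguishing number \<open>k \<ge> 3\<close> thus gives a zero-sum family \<open>y\<^sub>1, \<dots>, y\<^sub>k\<close> on
  which the products differ and which has no zero-sum proper subfamily, so \<open>y\<^sub>1, \<dots>, y\<^sub>k\<^sub>-\<^sub>1\<close> is a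
  basis. Any other nonzero \<open>z\<close> is the sum of at most \<open>k - 2\<close> of the \<open>y\<^sub>j\<close>, and also of the
  remaining at most \<open>k - 2\<close>; multiplying the two resulting relations forces \<open>f^(z) = g^(z) = 0\<close>.
  Hence \<open>2\<^sup>k\<^sup>-\<^sup>1 f(x) = c + \<Sum>\<^sub>j a\<^sub>j \<chi>\<^sub>j(x)\<close> and \<open>2\<^sup>k\<^sup>-\<^sup>1 g(x) = c + \<Sum>\<^sub>j b\<^sub>j \<chi>\<^sub>j(x)\<close> with \<open>b\<^sub>j = \<plusminus>a\<^sub>j \<noteq> 0\<close> and
  \<open>\<Prod>\<^sub>j b\<^sub>j = - \<Prod>\<^sub>j a\<^sub>j\<close>, where the signs \<open>\<chi>\<^sub>j(x)\<close> can be prescribed freely subject to having product 1.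
  Comparing \<open>f\<close> with translates of \<open>g\<close> gives \<open>2\<^sup>k\<^sup>-\<^sup>1 | 2 a\<^sub>j\<close>; nonnegativity of \<open>f\<close> and \<open>g\<close> gives
  \<open>c \<ge> \<Sum>\<^sub>j |a\<^sub>j|\<close>, and then one of \<open>f\<close>, \<open>g\<close> attains \<open>2\<^sup>1\<^sup>-\<^sup>k (c + \<Sum>\<^sub>j |a\<^sub>j|) \<ge> k\<close>.
  The case \<open>k = 2\<close> is separate because there \<open>|f^| = |g^|\<close> is not available.
\<close>

section \<open>Characters and the Fourier transform on the binary cube\<close>

text \<open>This is the character (-1)^(y . x). All characters here are real, so the transform stays
  in the integers, where divisibility can be used.\<close>

definition chi :: "bit ^ 'm \<Rightarrow> bit ^ 'm \<Rightarrow> int" where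
  "chi y x = (\<Prod>i\<in>UNIV. if y $ i = 1 \<and> x $ i = 1 then - 1 else 1)"

definition fourier :: "(bit ^ 'm \<Rightarrow> nat) \<Rightarrow> bit ^ 'm \<Rightarrow> int" where
  "fourier f y = (\<Sum>x\<in>UNIV. int (f x) * chi y x)"

lemma bit_vec_add_self [simp]: "x + x = 0" for x :: "bit ^ 'm"
  by (simp add: vec_eq_iff)

lemma bit_vec_add_eq_0_iff: "x + y = 0 \<longleftrightarrow> x = y" for x y :: "bit ^ 'm"
  by (metis add.assoc add.right_neutral bit_vec_add_self add.left_neutral)

lemma card_bit [simp]: "CARD(bit) = 2"
proof -
  have "(UNIV :: bit set) = {0, 1}"
    by (auto intro: bit_not_zero_iff [THEN iffD1])
  then show ?thesis
    by (metis card_2_iff zero_neq_one)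
qed

lemma chi_commute: "chi y x = chi x y"
  unfolding chi_def by (intro prod.cong) auto

lemma chi_0 [simp]: "chi 0 x = 1" "chi x 0 = 1"
  by (simp_all add: chi_def)

lemma chi_add_left: "chi (y + z) x = chi y x * chi z x"
proof -
  have "(if a + b = 1 \<and> c = 1 then - 1 else 1) =
      (if a = 1 \<and> c = 1 then - 1 else 1) * (if b = 1 \<and> c = 1 then - 1 else (1::int))" for a b c :: bit
    by (cases a; cases b; cases c) simp_all
  then show ?thesis
    unfolding chi_def prod.distrib [symmetric] by simp
qed

lemma chi_add_right: "chi y (x + z) = chi y x * chi y z"
  by (metis chi_add_left chi_commute)

lemma chi_sum_left: "chi (\<Sum>j\<in>A. y j) x = (\<Prod>j\<in>A. chi (y j) x)"
  by (induction A rule: infinite_finite_induct) (auto simp: chi_add_left)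

lemma chi_square [simp]: "chi y x * chi y x = 1"
  by (simp flip: chi_add_left)

lemma chi_cases: "chi y x = 1 \<or> chi y x = - 1"
  using chi_square [of y x] by (simp only: square_eq_1_iff)

lemma exists_chi_minus_1:
  assumes "y \<noteq> 0"
  obtains w where "chi y w = - 1"
proof -
  obtain i where i: "y $ i \<noteq> 0"
    using assms by (auto simp: vec_eq_iff)
  have "chi y (axis i 1) = (\<Prod>j\<in>UNIV. if j = i then - 1 else 1)"
    unfolding chi_def using i by (intro prod.cong) (auto simp: axis_def)
  also have "\<dots> = - 1"
    by simp
  finally show thesis
    by (rule that)
qed

lemma sum_shift: "(\<Sum>x\<in>UNIV. h (x + a)) = (\<Sum>x\<in>UNIV. h x)"
  for a :: "bit ^ 'm" and h :: "bit ^ 'm \<Rightarrow> 'b::comm_monoid_add"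
  by (rule sum.reindex_bij_witness [of _ "\<lambda>x. x + a" "\<lambda>x. x + a"]) (auto simp: add.assoc)

text \<open>Translating by a point where the character is -1 negates the sum.\<close>

lemma sum_chi: "(\<Sum>x\<in>UNIV. chi y x) = (if y = 0 then 2 ^ CARD('m) else 0)" for y :: "bit ^ 'm"
proof (cases "y = 0")
  case True
  then show ?thesis
    by simp
next
  case False
  then obtain w where w: "chi y w = - 1"
    by (rule exists_chi_minus_1)
  have "(\<Sum>x\<in>UNIV. chi y x) = (\<Sum>x\<in>UNIV. chi y (x + w))"
    by (simp add: sum_shift)
  also have "\<dots> = - (\<Sum>x\<in>UNIV. chi y x)"
    by (simp add: chi_add_right w sum_negf)
  finally show ?thesis
    using False by simp
qed

lemma fourier_inversion:
  "(\<Sum>y\<in>UNIV. fourier f y * chi y x) = 2 ^ CARD('m) * int (f x)" for x :: "bit ^ 'm"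
proof -
  have "(\<Sum>y\<in>UNIV. fourier f y * chi y x) = (\<Sum>y\<in>UNIV. \<Sum>z\<in>UNIV. int (f z) * chi (x + z) y)"
    unfolding fourier_def sum_distrib_right
    by (intro sum.cong refl) (simp add: chi_commute [of "x + _"] chi_add_right mult_ac)
  also have "\<dots> = (\<Sum>z\<in>UNIV. int (f z) * (\<Sum>y\<in>UNIV. chi (x + z) y))"
    by (subst sum.swap) (simp add: sum_distrib_left)
  also have "\<dots> = (\<Sum>z\<in>UNIV. if z = x then 2 ^ CARD('m) * int (f z) else 0)"
    by (intro sum.cong refl) (auto simp: sum_chi bit_vec_add_eq_0_iff)
  finally show ?thesis
    by simp
qed

lemma fourier_shift: "(\<Sum>x\<in>UNIV. int (f (a + x)) * chi y x) = chi y a * fourier f y"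
proof -
  have "(\<Sum>x\<in>UNIV. int (f (a + x)) * chi y x) = (\<Sum>x\<in>UNIV. chi y a * (int (f (x + a)) * chi y (x + a)))"
  proof (intro sum.cong refl)
    fix x
    have "chi y a * (int (f (x + a)) * chi y (x + a)) = int (f (x + a)) * chi y x * (chi y a * chi y a)"
      by (simp only: chi_add_right mult_ac)
    then show "int (f (a + x)) * chi y x = chi y a * (int (f (x + a)) * chi y (x + a))"
      by (simp only: chi_square mult_1_right add.commute)
  qed
  also have "\<dots> = chi y a * (\<Sum>x\<in>UNIV. int (f (x + a)) * chi y (x + a))"
    by (simp only: sum_distrib_left)
  also have "(\<Sum>x\<in>UNIV. int (f (x + a)) * chi y (x + a)) = fourier f y"
    unfolding fourier_def by (rule sum_shift)
  finally show ?thesis .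
qed

section \<open>Decks on the Fourier side\<close>

text \<open>For fixed \<open>g\<close> the transform in \<open>i\<close> variables splits into a
  product of shifted transforms. By \<open>sum_chi\<close> the last factor is a nonzero constant on
  zero-sum families, so there the decks determine the products.\<close>

lemma fourier_deck:
  "(\<Sum>s\<in>Pi\<^sub>E {1..i} (\<lambda>_. UNIV). int (deck i f s) * (\<Prod>j=1..i. chi (y j) (s j))) =
    (\<Prod>j=1..i. fourier f (y j)) * (\<Sum>g\<in>UNIV. chi (\<Sum>j=1..i. y j) g)"
  (is "?L = _")
proof -
  have "?L = (\<Sum>g\<in>UNIV. \<Sum>s\<in>Pi\<^sub>E {1..i} (\<lambda>_. UNIV). \<Prod>j=1..i. int (f (g + s j)) * chi (y j) (s j))"
    unfolding deck_def by (subst sum.swap) (simp add: sum_distrib_right prod.distrib)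
  also have "\<dots> = (\<Sum>g\<in>UNIV. \<Prod>j=1..i. \<Sum>x\<in>UNIV. int (f (g + x)) * chi (y j) x)"
    by (subst prod_sum_PiE) simp_all
  also have "\<dots> = (\<Sum>g\<in>UNIV. (\<Prod>j=1..i. fourier f (y j)) * chi (\<Sum>j=1..i. y j) g)"
    unfolding fourier_shift chi_sum_left prod.distrib by (simp only: mult.commute)
  finally show ?thesis
    by (simp add: sum_distrib_left)
qed

text \<open>The converse direction inverts every factor; by \<open>sum_chi\<close> only zero-sum
  families contribute to the deck.\<close>

lemma deck_fourier:
  "(2 ^ CARD('m)) ^ i * int (deck i f s) =
    (\<Sum>y\<in>Pi\<^sub>E {1..i} (\<lambda>_. UNIV). (\<Prod>j=1..i. fourier f (y j)) * (\<Prod>j=1..i. chi (y j) (s j)) *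
      (\<Sum>g\<in>UNIV. chi (\<Sum>j=1..i. y j) g))"
  (is "_ = ?R") for s :: "nat \<Rightarrow> bit ^ 'm"
proof -
  have "(2 ^ CARD('m)) ^ i * int (deck i f s) = (\<Sum>g\<in>UNIV. \<Prod>j=1..i. 2 ^ CARD('m) * int (f (g + s j)))"
    unfolding deck_def by (simp add: sum_distrib_left prod.distrib)
  also have "\<dots> = (\<Sum>g\<in>UNIV. \<Prod>j=1..i. \<Sum>z\<in>UNIV. fourier f z * chi z (g + s j))"
    by (simp add: fourier_inversion)
  also have "\<dots> = (\<Sum>g\<in>UNIV. \<Sum>y\<in>Pi\<^sub>E {1..i} (\<lambda>_. UNIV). \<Prod>j=1..i. fourier f (y j) * chi (y j) (g + s j))"
    by (subst prod_sum_PiE) simp_all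
  also have "\<dots> = ?R"
    by (subst sum.swap) (simp add: sum_distrib_left chi_sum_left chi_add_right prod.distrib mult_ac)
  finally show ?thesis .
qed

lemma deck_eq_iff_fourier:
  fixes f g :: "bit ^ 'm \<Rightarrow> nat"
  shows "(\<forall>s. deck i f s = deck i g s) \<longleftrightarrow>
    (\<forall>y. (\<Sum>j=1..i. y j) = 0 \<longrightarrow> (\<Prod>j=1..i. fourier f (y j)) = (\<Prod>j=1..i. fourier g (y j)))"
  (is "?D \<longleftrightarrow> ?F")
proof
  assume D: ?D
  show ?F
  proof (intro allI impI)
    fix y :: "nat \<Rightarrow> bit ^ 'm"
    assume "(\<Sum>j=1..i. y j) = 0"
    then show "(\<Prod>j=1..i. fourier f (y j)) = (\<Prod>j=1..i. fourier g (y j))"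
      using fourier_deck [of i f y] fourier_deck [of i g y] D by (simp add: sum_chi)
  qed
next
  assume F: ?F
  show ?D
  proof
    fix s :: "nat \<Rightarrow> bit ^ 'm"
    have "(2 ^ CARD('m)) ^ i * int (deck i f s) = (2 ^ CARD('m)) ^ i * int (deck i g s)"
      unfolding deck_fourier using F by (intro sum.cong refl) (auto simp: sum_chi)
    then show "deck i f s = deck i g s"
      by simp
  qed
qed

text \<open>Arbitrary index sets replace \<open>{1..i}\<close>, so that subfamilies and their
  complements can be used without renumbering.\<close>

lemma indistinguishable_fourier_prod:
  assumes "indistinguishable k f g" "finite I" "card I \<le> k" "(\<Sum>j\<in>I. y j) = 0"
  shows "(\<Prod>j\<in>I. fourier f (y j)) = (\<Prod>j\<in>I. fourier g (y j))"
proof -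
  obtain b where b: "bij_betw b {1..card I} I"
    using ex_bij_betw_nat_finite_1 [OF assms(2)] by blast
  have "(\<Sum>j=1..card I. y (b j)) = 0"
    using assms(4) sum.reindex_bij_betw [OF b, of y] by simp
  then have "(\<Prod>j=1..card I. fourier f (y (b j))) = (\<Prod>j=1..card I. fourier g (y (b j)))"
    using assms(1,3) deck_eq_iff_fourier [of "card I" f g] unfolding indistinguishable_def by auto
  then show ?thesis
    using prod.reindex_bij_betw [OF b, of "\<lambda>j. fourier f (y j)"]
      prod.reindex_bij_betw [OF b, of "\<lambda>j. fourier g (y j)"] by simp
qed

section \<open>Zero-sum circuits\<close>

text \<open>Terms over the intersection occur twice and cancel in characteristic 2.\<close>

lemma sum_sym_diff:
  fixes y :: "'i \<Rightarrow> bit ^ 'm"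
  assumes "finite A" "finite B"
  shows "(\<Sum>j\<in>(A - B) \<union> (B - A). y j) = (\<Sum>j\<in>A. y j) + (\<Sum>j\<in>B. y j)"
proof -
  have "(\<Sum>j\<in>A. y j) + (\<Sum>j\<in>B. y j) =
      (\<Sum>j\<in>A - B. y j) + (\<Sum>j\<in>B - A. y j) + ((\<Sum>j\<in>A \<inter> B. y j) + (\<Sum>j\<in>A \<inter> B. y j))"
    using sum.Int_Diff [OF assms(1), of y B] sum.Int_Diff [OF assms(2), of y A]
    by (simp only: Int_commute [of B A] ac_simps)
  also have "\<dots> = (\<Sum>j\<in>A - B. y j) + (\<Sum>j\<in>B - A. y j)"
    by (simp only: bit_vec_add_self add.right_neutral)
  also have "\<dots> = (\<Sum>j\<in>(A - B) \<union> (B - A). y j)"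
    using assms by (subst sum.union_disjoint) auto
  finally show ?thesis ..
qed

text \<open>A spanning circuit of the binary matroid: the total sum is the only nontrivial linear
  relation among the \<open>k\<close> vectors.\<close>

locale zero_sum_circuit =
  fixes k :: nat and y :: "nat \<Rightarrow> bit ^ 'm"
  assumes k_pos: "k \<ge> 1"
    and card_index: "CARD('m) = k - 1"
    and sum_eq_0: "(\<Sum>j=1..k. y j) = 0"
    and proper_sum_ne_0: "\<And>A. A \<subset> {1..k} \<Longrightarrow> A \<noteq> {} \<Longrightarrow> (\<Sum>j\<in>A. y j) \<noteq> 0"
begin

lemma insert_last: "{1..k} = insert k {1..<k}"
  using k_pos by auto

lemma sum_complement:
  assumes "A \<subseteq> {1..k}"
  shows "(\<Sum>j\<in>{1..k} - A. y j) = (\<Sum>j\<in>A. y j)"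
  using sum.subset_diff [OF assms, of y] sum_eq_0 by (simp add: bit_vec_add_eq_0_iff)

text \<open>If two subsets have equal sums, their symmetric difference has sum 0 and omits
  \<open>k\<close>, so it is empty. Thus subset sums are injective, and there are as many subsets as
  vectors.\<close>

lemma subset_sums_surj: "\<exists>A\<subseteq>{1..<k}. z = (\<Sum>j\<in>A. y j)"
proof -
  have inj: "inj_on (\<lambda>A. \<Sum>j\<in>A. y j) (Pow {1..<k})"
  proof (rule inj_onI)
    fix A B
    assume A: "A \<in> Pow {1..<k}" and B: "B \<in> Pow {1..<k}"
      and eq: "(\<Sum>j\<in>A. y j) = (\<Sum>j\<in>B. y j)"
    have fin: "finite A" "finite B"
      using A B finite_subset by auto
    have "k \<notin> (A - B) \<union> (B - A)" "(A - B) \<union> (B - A) \<subseteq> {1..k}"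
      using A B by auto
    then have "(A - B) \<union> (B - A) \<subset> {1..k}"
      using insert_last by blast
    moreover have "(\<Sum>j\<in>(A - B) \<union> (B - A). y j) = 0"
      by (simp only: sum_sym_diff [OF fin] eq bit_vec_add_self)
    ultimately have "(A - B) \<union> (B - A) = {}"
      using proper_sum_ne_0 by blast
    then show "A = B"
      by blast
  qed
  have "card ((\<lambda>A. \<Sum>j\<in>A. y j) ` Pow {1..<k}) = CARD(bit ^ 'm)"
    unfolding card_image [OF inj] by (simp add: card_Pow card_index)
  then have "(\<lambda>A. \<Sum>j\<in>A. y j) ` Pow {1..<k} = UNIV"
    by (intro card_subset_eq) auto
  then have "z \<in> (\<lambda>A. \<Sum>j\<in>A. y j) ` Pow {1..<k}"
    by simp
  then show ?thesis
    by blast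
qed

text \<open>Since the \<open>y j\<close> generate, a point is determined by its first
  \<open>k - 1\<close> signs, and by counting every pattern of these occurs. The product condition
  then forces the sign at \<open>k\<close>.\<close>

lemma exists_point_with_signs:
  assumes \<sigma>: "\<And>j. j \<in> {1..k} \<Longrightarrow> \<sigma> j = 1 \<or> \<sigma> j = - 1" and prod: "(\<Prod>j=1..k. \<sigma> j) = 1"
  shows "\<exists>x. \<forall>j\<in>{1..k}. chi (y j) x = \<sigma> j"
proof -
  define N where "N x = {j \<in> {1..<k}. chi (y j) x = - 1}" for x
  have "inj N"
  proof (rule injI)
    fix u v
    assume uv: "N u = N v"
    have *: "chi (y j) (u + v) = 1" if "j \<in> {1..<k}" for j
    proof -
      have "chi (y j) u = - 1 \<longleftrightarrow> chi (y j) v = - 1"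
        using uv that unfolding N_def by blast
      then have "chi (y j) u = chi (y j) v"
        using chi_cases [of "y j" u] chi_cases [of "y j" v] by argo
      then show ?thesis
        by (simp add: chi_add_right)
    qed
    have "chi z (u + v) = 1" for z
    proof -
      obtain A where "A \<subseteq> {1..<k}" "z = (\<Sum>j\<in>A. y j)"
        using subset_sums_surj by blast
      then show ?thesis
        using * by (auto simp: chi_sum_left intro!: prod.neutral)
    qed
    then have "u + v = 0"
      using exists_chi_minus_1 [of "u + v"] chi_commute by (metis one_neq_neg_one)
    then show "u = v"
      by (simp add: bit_vec_add_eq_0_iff)
  qed
  then have "card (range N) = card (Pow {1..<k})"
    by (simp add: card_image card_Pow card_index)
  then have "range N = Pow {1..<k}"
    by (intro card_subset_eq) (auto simp: N_def)
  then have "{j \<in> {1..<k}. \<sigma> j = - 1} \<in> range N"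
    by auto
  then obtain x where x: "N x = {j \<in> {1..<k}. \<sigma> j = - 1}"
    unfolding image_iff by metis
  have less: "chi (y j) x = \<sigma> j" if j: "j \<in> {1..<k}" for j
  proof -
    have "chi (y j) x = - 1 \<longleftrightarrow> \<sigma> j = - 1"
      using x j unfolding N_def by blast
    moreover have "\<sigma> j = 1 \<or> \<sigma> j = - 1"
      using j by (intro \<sigma>) auto
    ultimately show ?thesis
      using chi_cases [of "y j" x] by argo
  qed
  have "(\<Prod>j=1..k. chi (y j) x) = 1"
    by (metis chi_0(1) chi_sum_left sum_eq_0)
  then have "chi (y k) x * (\<Prod>j\<in>{1..<k}. \<sigma> j) = \<sigma> k * (\<Prod>j\<in>{1..<k}. \<sigma> j)"
    using prod less unfolding insert_last by simp
  moreover have "(\<Prod>j\<in>{1..<k}. \<sigma> j) \<noteq> 0"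
    using prod unfolding insert_last
    by (metis atLeastLessThan_iff finite_atLeastLessThan less_irrefl mult_zero_right prod.insert zero_neq_one)
  ultimately have "chi (y k) x = \<sigma> k"
    by simp
  with less show ?thesis
    unfolding insert_last by auto
qed

section \<open>From the coefficients to a large multiplicity\<close>

text \<open>The sign assumptions single out \<open>f\<close>: the signs of the \<open>a j\<close>
  have product 1, so some point makes all terms of its expansion positive at once.\<close>

lemma large_multiplicity:
  fixes f g :: "bit ^ 'm \<Rightarrow> nat"
  assumes f: "\<And>x. 2 ^ (k - 1) * int (f x) = c + (\<Sum>j=1..k. a j * chi (y j) x)"
    and g: "\<And>x. 2 ^ (k - 1) * int (g x) = c + (\<Sum>j=1..k. b j * chi (y j) x)"
    and abs_eq: "\<And>j. \<bar>a j\<bar> = \<bar>b j\<bar>"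
    and pos: "(\<Prod>j=1..k. a j) > 0" and neg: "(\<Prod>j=1..k. b j) < 0"
  shows "\<exists>x. f x \<ge> k"
proof -
  have sgn_prod: "sgn (\<Prod>j\<in>A. h j) = (\<Prod>j\<in>A. sgn (h j))" for A :: "nat set" and h :: "nat \<Rightarrow> int"
    by (induction A rule: infinite_finite_induct) (simp_all add: sgn_mult)
  have a0: "a j \<noteq> 0" if "j \<in> {1..k}" for j
    using pos that prod_zero [of "{1..k}" a] by (metis finite_atLeastAtMost less_irrefl)
  have b0: "b j \<noteq> 0" if "j \<in> {1..k}" for j
    using a0 [OF that] abs_eq [of j] by auto
  have sgn_cases: "sgn u = 1 \<or> sgn u = - 1" if "u \<noteq> 0" for u :: int
    using that by (simp add: sgn_if)
  have prod_a: "(\<Prod>j=1..k. sgn (a j)) = 1" and prod_b: "(\<Prod>j=1..k. sgn (b j)) = - 1"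
    using pos neg by (simp_all flip: sgn_prod)
  \<comment> \<open>Translate \<open>g\<close> so that its coefficients match those of \<open>f\<close> except for the sign of the \<open>i\<close>-th.\<close>
  have large: "2 ^ (k - 1) \<le> 2 * \<bar>a i\<bar>" if i: "i \<in> {1..k}" for i
  proof -
    define \<sigma> where "\<sigma> j = sgn (a j) * sgn (b j) * (if j = i then - 1 else 1)" for j
    \<comment> \<open>The signs of \<open>a\<close> and \<open>b\<close> together contribute -1,
      which the flip at \<open>i\<close> corrects.\<close>
    have "(\<Prod>j=1..k. \<sigma> j) = 1"
      using i by (simp add: \<sigma>_def prod.distrib prod_a prod_b del: One_nat_def)
    moreover have "\<sigma> j = 1 \<or> \<sigma> j = - 1" if "j \<in> {1..k}" for j
      using sgn_cases [OF a0 [OF that]] sgn_cases [OF b0 [OF that]] by (auto simp: \<sigma>_def)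
    ultimately obtain t where t: "\<forall>j\<in>{1..k}. chi (y j) t = \<sigma> j"
      using exists_point_with_signs by blast
    have "b j * \<sigma> j = a j * (if j = i then - 1 else 1)" for j
    proof -
      have "b j * \<sigma> j = (b j * sgn (b j)) * sgn (a j) * (if j = i then - 1 else 1)"
        by (simp add: \<sigma>_def)
      also have "b j * sgn (b j) = \<bar>a j\<bar>"
        by (simp only: abs_eq) (simp only: abs_sgn)
      also have "\<bar>a j\<bar> * sgn (a j) = a j"
        by (simp add: abs_mult_sgn)
      finally show ?thesis .
    qed
    then have "2 ^ (k - 1) * int (g t) = c + (\<Sum>j=1..k. a j * (if j = i then - 1 else 1))"
      using g [of t] t by simp
    \<comment> \<open>All characters are 1 at 0, so only the \<open>i\<close>-th terms survive in
      the difference.\<close>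
    then have "2 ^ (k - 1) * (int (f 0) - int (g t)) =
        (\<Sum>j=1..k. a j - a j * (if j = i then - 1 else 1))"
      using f [of 0] by (simp only: right_diff_distrib sum_subtractf) simp
    also have "\<dots> = (\<Sum>j=1..k. if j = i then 2 * a i else 0)"
      by (intro sum.cong) auto
    also have "\<dots> = 2 * a i"
      using i by simp
    finally have "(2::int) ^ (k - 1) dvd 2 * a i"
      by (metis dvd_triv_left)
    then have "2 ^ (k - 1) \<le> \<bar>2 * a i\<bar>"
      using a0 [OF i] by (intro zdvd_imp_le) auto
    then show ?thesis
      by (simp add: abs_mult)
  qed
  obtain x where "\<forall>j\<in>{1..k}. chi (y j) x = sgn (a j)"
    using exists_point_with_signs [of "\<lambda>j. sgn (a j)"] prod_a sgn_cases a0 by blast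
  then have x: "2 ^ (k - 1) * int (f x) = c + (\<Sum>j=1..k. \<bar>a j\<bar>)"
    by (simp add: f abs_sgn del: One_nat_def)
  \<comment> \<open>The signs opposite to all coefficients are attainable for \<open>f\<close> or for \<open>g\<close>, by parity of \<open>k\<close>.\<close>
  have "(\<Sum>j=1..k. \<bar>a j\<bar>) \<le> c"
  proof (cases "even k")
    case True
    have "(\<Prod>j=1..k. - sgn (a j)) = 1"
      using True by (simp add: prod_uminus prod_a del: One_nat_def)
    moreover have "- sgn (a j) = 1 \<or> - sgn (a j) = - 1" if "j \<in> {1..k}" for j
      using sgn_cases [OF a0 [OF that]] by auto
    ultimately obtain x' where "\<forall>j\<in>{1..k}. chi (y j) x' = - sgn (a j)"
      using exists_point_with_signs [of "\<lambda>j. - sgn (a j)"] by blast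
    then have "2 ^ (k - 1) * int (f x') = c - (\<Sum>j=1..k. \<bar>a j\<bar>)"
      by (simp add: f abs_sgn sum_negf del: One_nat_def)
    moreover have "0 \<le> 2 ^ (k - 1) * int (f x')"
      by simp
    ultimately show ?thesis
      by linarith
  next
    case False
    have "(\<Prod>j=1..k. - sgn (b j)) = 1"
      using False by (simp add: prod_uminus prod_b del: One_nat_def)
    moreover have "- sgn (b j) = 1 \<or> - sgn (b j) = - 1" if "j \<in> {1..k}" for j
      using sgn_cases [OF b0 [OF that]] by auto
    ultimately obtain x' where "\<forall>j\<in>{1..k}. chi (y j) x' = - sgn (b j)"
      using exists_point_with_signs [of "\<lambda>j. - sgn (b j)"] by blast
    then have "2 ^ (k - 1) * int (g x') = c - (\<Sum>j=1..k. \<bar>a j\<bar>)"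
      unfolding abs_eq by (simp add: g abs_sgn sum_negf del: One_nat_def)
    moreover have "0 \<le> 2 ^ (k - 1) * int (g x')"
      by simp
    ultimately show ?thesis
      by linarith
  qed
  \<comment> \<open>Sum \<open>large\<close> over all \<open>k\<close> indices; the factor 2 is
    absorbed because \<open>c\<close> is at least the sum of the absolute values.\<close>
  moreover have "2 ^ (k - 1) * int k \<le> 2 * (\<Sum>j=1..k. \<bar>a j\<bar>)"
    using sum_mono [of "{1..k}" "\<lambda>_. 2 ^ (k - 1)" "\<lambda>j. 2 * \<bar>a j\<bar>", OF large]
    by (simp add: sum_distrib_left mult.commute)
  ultimately have "2 ^ (k - 1) * int k \<le> 2 ^ (k - 1) * int (f x)"
    unfolding x by linarith
  then have "k \<le> f x"
    by simp
  then show ?thesis ..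
qed

section \<open>Support of the transforms\<close>

lemma fourier_eq_0_off_circuit:
  fixes f g :: "bit ^ 'm \<Rightarrow> nat"
  assumes ind: "indistinguishable (k - 1) f g"
    and ne: "(\<Prod>j=1..k. fourier f (y j)) \<noteq> (\<Prod>j=1..k. fourier g (y j))"
    and sq: "\<And>z. fourier f z * fourier f z = fourier g z * fourier g z"
    and z: "z \<noteq> 0" "z \<notin> y ` {1..k}"
  shows "fourier f z = 0"
proof -
  \<comment> \<open>Adjoining \<open>z\<close> at the free index 0 gives a zero-sum family with at
    most \<open>k - 1\<close> members.\<close>
  have relation: "fourier f z * (\<Prod>j\<in>A. fourier f (y j)) = fourier g z * (\<Prod>j\<in>A. fourier g (y j))"
    if A: "A \<subseteq> {1..k}" "card A \<le> k - 2" "z = (\<Sum>j\<in>A. y j)" for A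
  proof -
    have fin: "finite A" and 0: "0 \<notin> A"
      using A(1) finite_subset by auto
    have "A \<noteq> {}"
      using A(3) z(1) by auto
    then have "card A \<noteq> 0"
      using fin by simp
    then have card: "card (insert 0 A) \<le> k - 1"
      using A(2) unfolding card_insert_disjoint [OF fin 0] by linarith
    have eq: "(\<Sum>j\<in>A. (y(0 := z)) j) = (\<Sum>j\<in>A. y j)"
      "(\<Prod>j\<in>A. fourier h ((y(0 := z)) j)) = (\<Prod>j\<in>A. fourier h (y j))" for h
      using 0 by (auto intro!: sum.cong prod.cong)
    have "(\<Sum>j\<in>insert 0 A. (y(0 := z)) j) = 0"
      unfolding sum.insert [OF fin 0] eq A(3) [symmetric] by simp
    from indistinguishable_fourier_prod [OF ind _ card this] show ?thesis
      using fin unfolding prod.insert [OF fin 0] eq by simp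
  qed
  obtain A where A: "A \<subseteq> {1..<k}" "z = (\<Sum>j\<in>A. y j)"
    using subset_sums_surj by blast
  have A': "A \<subseteq> {1..k}" "finite A"
    using A(1) insert_last finite_subset by auto
  have "card A \<noteq> 0"
    using A(2) z(1) A'(2) by auto
  moreover have "card A \<noteq> 1"
    using A(2) z(2) A'(1) by (auto simp: card_1_singleton_iff)
  \<comment> \<open>Hence the complement of \<open>A\<close> has at most \<open>k - 2\<close>
    indices.\<close>
  ultimately have ge2: "2 \<le> card A"
    by linarith
  \<comment> \<open>This rules out \<open>A = {1..<k}\<close>, so \<open>A\<close> too has at most
    \<open>k - 2\<close> indices.\<close>
  have "(\<Sum>j\<in>{1..<k}. y j) = y k"
    using sum_eq_0 unfolding insert_last by (simp add: bit_vec_add_eq_0_iff)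
  then have "A \<noteq> {1..<k}"
    using A(2) z(2) k_pos by auto
  then have "card A < card {1..<k}"
    using A(1) by (intro psubset_card_mono) auto
  then have "fourier f z * (\<Prod>j\<in>A. fourier f (y j)) = fourier g z * (\<Prod>j\<in>A. fourier g (y j))"
    using A A' by (intro relation) auto
  moreover have "fourier f z * (\<Prod>j\<in>{1..k} - A. fourier f (y j)) =
      fourier g z * (\<Prod>j\<in>{1..k} - A. fourier g (y j))"
    using A(2) A' ge2
    by (intro relation) (auto simp: card_Diff_subset sum_complement [OF A'(1)] simp del: One_nat_def)
  ultimately have "(fourier f z * (\<Prod>j\<in>{1..k} - A. fourier f (y j))) *
        (fourier f z * (\<Prod>j\<in>A. fourier f (y j))) =
      (fourier g z * (\<Prod>j\<in>{1..k} - A. fourier g (y j))) *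
        (fourier g z * (\<Prod>j\<in>A. fourier g (y j)))"
    by (rule arg_cong2 [where f = times, rotated])
  \<comment> \<open>The products over \<open>A\<close> and its complement combine into the full
    products, which differ by \<open>ne\<close>.\<close>
  then have "(fourier f z * fourier f z) * (\<Prod>j=1..k. fourier f (y j)) =
      (fourier g z * fourier g z) * (\<Prod>j=1..k. fourier g (y j))"
    unfolding prod.subset_diff [OF A'(1) finite_atLeastAtMost] by (simp only: mult_ac)
  then have "(fourier f z * fourier f z) * (\<Prod>j=1..k. fourier f (y j)) =
      (fourier f z * fourier f z) * (\<Prod>j=1..k. fourier g (y j))"
    by (simp only: sq)
  with ne show ?thesis
    by simp
qed

lemma fourier_expansion:
  fixes f :: "bit ^ 'm \<Rightarrow> nat"
  assumes "k \<ge> 3" and supp: "\<And>z. z \<noteq> 0 \<Longrightarrow> z \<notin> y ` {1..k} \<Longrightarrow> fourier f z = 0"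
  shows "2 ^ (k - 1) * int (f x) = fourier f 0 + (\<Sum>j=1..k. fourier f (y j) * chi (y j) x)"
proof -
  \<comment> \<open>As \<open>k\<close> is at least 3, index pairs are proper subsets, and two equal
    vectors would sum to 0.\<close>
  have inj: "inj_on y {1..k}"
  proof (rule inj_onI, rule ccontr)
    fix i j
    assume ij: "i \<in> {1..k}" "j \<in> {1..k}" "y i = y j" "i \<noteq> j"
    have "card {i, j} \<noteq> card {1..k}"
      using ij(4) assms(1) by simp
    moreover have "{i, j} \<subseteq> {1..k}"
      using ij by simp
    ultimately have "{i, j} \<subset> {1..k}"
      by (metis psubsetI)
    from proper_sum_ne_0 [OF this] show False
      using ij by simp
  qed
  have ne0: "0 \<notin> y ` {1..k}"
  proof
    assume "0 \<in> y ` {1..k}"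
    then obtain j where j: "j \<in> {1..k}" "y j = 0"
      by auto
    have "card {j} \<noteq> card {1..k}"
      using assms(1) by simp
    moreover have "{j} \<subseteq> {1..k}"
      using j by simp
    ultimately have "{j} \<subset> {1..k}"
      by (metis psubsetI)
    from proper_sum_ne_0 [OF this] show False
      using j by simp
  qed
  have "2 ^ (k - 1) * int (f x) = (\<Sum>z\<in>UNIV. fourier f z * chi z x)"
    by (simp add: fourier_inversion card_index)
  also have "\<dots> = (\<Sum>z\<in>insert 0 (y ` {1..k}). fourier f z * chi z x)"
    using supp by (intro sum.mono_neutral_right) auto
  also have "\<dots> = fourier f 0 + (\<Sum>z\<in>y ` {1..k}. fourier f z * chi z x)"
    using ne0 by simp
  also have "(\<Sum>z\<in>y ` {1..k}. fourier f z * chi z x) = (\<Sum>j=1..k. fourier f (y j) * chi (y j) x)"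
    by (simp only: sum.reindex [OF inj] o_def)
  finally show ?thesis .
qed

end

section \<open>The case \<open>k = 2\<close> and the conclusion\<close>

lemma indistinguishable_sym: "indistinguishable k f g \<longleftrightarrow> indistinguishable k g f"
  by (auto simp: indistinguishable_def)

text \<open>On a two-point group, 0/1-valued functions with the same total are equal or translates
  of each other.\<close>

lemma indistinguishable_2_if_le_1:
  fixes f g :: "bit ^ 'm \<Rightarrow> nat"
  assumes "CARD('m) = 1" and ind: "indistinguishable 1 f g"
    and le: "\<And>x. f x \<le> 1" "\<And>x. g x \<le> 1"
  shows "indistinguishable 2 f g"
proof -
  have "card (UNIV - {0 :: bit ^ 'm}) = 1"
    using assms(1) by (simp add: card_Diff_subset)
  then obtain e :: "bit ^ 'm" where e: "UNIV - {0} = {e}"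
    by (rule card_1_singletonE)
  then have UNIV: "UNIV = {0, e}" and "e \<noteq> 0"
    by auto
  \<comment> \<open>The 1-deck is the total multiplicity.\<close>
  have eq: "f 0 + f e = g 0 + g e"
    using ind \<open>e \<noteq> 0\<close> unfolding indistinguishable_def deck_def UNIV
    by (auto dest!: spec [of _ 1] spec [of _ "\<lambda>_. 0"])
  have "deck 2 f s = deck 2 g s" for s
  proof -
    have s: "s 1 = 0 \<or> s 1 = e" "s 2 = 0 \<or> s 2 = e"
      using UNIV by auto
    have d: "deck 2 h s = h (s 1) * h (s 2) + h (e + s 1) * h (e + s 2)" for h :: "bit ^ 'm \<Rightarrow> nat"
      using \<open>e \<noteq> 0\<close> unfolding deck_def UNIV by (simp add: numeral_2_eq_2)
    have "f 0 = 0 \<or> f 0 = 1" "f e = 0 \<or> f e = 1" "g 0 = 0 \<or> g 0 = 1" "g e = 0 \<or> g e = 1"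
      using le by (metis le_less_linear less_one antisym)+
    with eq s show ?thesis
      unfolding d by (elim disjE) simp_all
  qed
  moreover have "i \<le> 2 \<longleftrightarrow> i \<le> 1 \<or> i = 2" for i :: nat
    by auto
  ultimately show ?thesis
    using ind by (auto simp: indistinguishable_def)
qed

theorem theorem4p5:
  fixes k :: nat and f g :: "bit ^ 'm \<Rightarrow> nat"
  assumes "k \<ge> 2"
    and "CARD('m) = k - 1"
    and "has_distinguishing_number f g k"
  shows "\<exists>x. f x \<ge> k \<or> g x \<ge> k"
proof -
  have dist: "distinguishable k f g" and ind: "indistinguishable (k - 1) f g"
    using assms(1,3) by (force simp: has_distinguishing_number_def)+
  show ?thesis
  proof (cases "k = 2")
    case True
    show ?thesis
    proof (rule ccontr)
      assume "\<not> ?thesis"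
      then have "\<And>x. f x \<le> 1" "\<And>x. g x \<le> 1"
        using True by (auto simp: not_le less_2_cases_iff le_Suc_eq)
      then show False
        using indistinguishable_2_if_le_1 [of f g] assms(2) dist ind True by simp
    qed
  next
    case False
    with assms(1) have k3: "k \<ge> 3"
      by simp
    have "\<not> (\<forall>s. deck k f s = deck k g s)"
    proof
      assume "\<forall>s. deck k f s = deck k g s"
      moreover have "i \<le> k \<Longrightarrow> i \<le> k - 1 \<or> i = k" for i
        by auto
      ultimately have "indistinguishable k f g"
        using ind unfolding indistinguishable_def by blast
      with dist show False ..
    qed
    then obtain y :: "nat \<Rightarrow> bit ^ 'm" where sum0: "(\<Sum>j=1..k. y j) = 0"
      and ne: "(\<Prod>j=1..k. fourier f (y j)) \<noteq> (\<Prod>j=1..k. fourier g (y j))"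
      unfolding deck_eq_iff_fourier by blast
    \<comment> \<open>If a proper nonempty subfamily had sum 0, so would its complement. The
      products agree on both, as each has at most \<open>k - 1\<close> members, and multiplying
      contradicts \<open>ne\<close>.\<close>
    interpret zero_sum_circuit k y
    proof
      fix A
      assume A: "A \<subset> {1..k}" "A \<noteq> {}"
      show "(\<Sum>j\<in>A. y j) \<noteq> 0"
      proof
        assume A0: "(\<Sum>j\<in>A. y j) = 0"
        have fin: "finite A" and sub: "A \<subseteq> {1..k}"
          using A(1) finite_subset by auto
        have B0: "(\<Sum>j\<in>{1..k} - A. y j) = 0"
          using sum.subset_diff [OF sub, of y] sum0 A0 by simp
        have "card A < k"
          using psubset_card_mono [OF _ A(1)] by simp
        moreover have "card A > 0"
          using A(2) fin by (simp add: card_gt_0_iff)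
        ultimately have "card A \<le> k - 1" "card ({1..k} - A) \<le> k - 1"
          using fin sub by (simp_all add: card_Diff_subset)
        from indistinguishable_fourier_prod [OF ind _ this(1) A0]
          indistinguishable_fourier_prod [OF ind _ this(2) B0]
        have "(\<Prod>j=1..k. fourier f (y j)) = (\<Prod>j=1..k. fourier g (y j))"
          using prod.subset_diff [OF sub, of "\<lambda>j. fourier f (y j)"]
            prod.subset_diff [OF sub, of "\<lambda>j. fourier g (y j)"] fin by simp
        with ne show False ..
      qed
    qed (use assms sum0 in auto)
    have at0: "fourier f 0 = fourier g 0"
      using indistinguishable_fourier_prod [OF ind, of "{0 :: nat}" "\<lambda>_. 0"] k3 by simp
    \<comment> \<open>The family \<open>z, z\<close> has sum 0, and \<open>k - 1\<close> is at least
      2.\<close>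
    have sq: "fourier f z * fourier f z = fourier g z * fourier g z" for z
      using indistinguishable_fourier_prod [OF ind, of "{0 :: nat, 1}" "\<lambda>_. z"] k3 by simp
    have abs_eq: "\<bar>fourier f z\<bar> = \<bar>fourier g z\<bar>" for z
      using sq [of z] by (simp add: abs_eq_iff square_eq_iff)
    have expand_f: "2 ^ (k - 1) * int (f x) =
        fourier f 0 + (\<Sum>j=1..k. fourier f (y j) * chi (y j) x)" for x
      using fourier_eq_0_off_circuit [OF ind ne sq] by (intro fourier_expansion k3)
    have expand_g: "2 ^ (k - 1) * int (g x) =
        fourier f 0 + (\<Sum>j=1..k. fourier g (y j) * chi (y j) x)" for x
      unfolding at0
      using fourier_eq_0_off_circuit [OF ind [unfolded indistinguishable_sym [of _ f]]
          ne [symmetric] sq [symmetric]]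
      by (intro fourier_expansion k3)
    have "\<bar>\<Prod>j=1..k. fourier f (y j)\<bar> = \<bar>\<Prod>j=1..k. fourier g (y j)\<bar>"
      by (simp add: abs_eq_iff flip: square_eq_iff) (simp add: sq flip: prod.distrib)
    \<comment> \<open>The full products are distinct with equal absolute values, so their signs are
      opposite.\<close>
    with ne consider
        "(\<Prod>j=1..k. fourier f (y j)) > 0" "(\<Prod>j=1..k. fourier g (y j)) < 0"
      | "(\<Prod>j=1..k. fourier g (y j)) > 0" "(\<Prod>j=1..k. fourier f (y j)) < 0"
      by linarith
    then show ?thesis
    proof cases
      case 1
      then show ?thesis
        using large_multiplicity [OF expand_f expand_g abs_eq] by blast
    next
      case 2
      then show ?thesis
        using large_multiplicity [OF expand_g expand_f abs_eq [symmetric]] by blast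
    qed
  qed
qed

end
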